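(* Let $G$ be a just infinite profinite group, and let $H$ be a subgroup of $G$ of (finite) index $h$. (i) For all sufficiently large $n$: $$h^{-1}\,\mathrm{ob}_G(hn)\le \mathrm{ob}_H(n).$$ (ii) Let $t=|G:\mathrm{Core}_G(H)|$. For all $n$: $$\mathrm{ob}^*_H(n)\le h^{-1}\,\mathrm{ob}^*_G(tn^h).$$ (iii) For a given $n$, let $\mathcal{I}_n$ be the set of subgroups of $G$ containing $I^\lhd_n(G)$. Then: $$\mathrm{ob}^*_G(n)\le\prod_{L\in\mathcal{I}_n}|G:L|\,\mathrm{ob}_L(n).$$
   Context: All subgroups are closed. A profinite group is just infinite if it is infinite and every non-trivial normal subgroup has finite index. $\mathrm{Core}_G(H)$ is the intersection of the $G$-conjugates of $H$. $n$ ranges over positive integers. For a profinite group $G$ and a subgroup $H$, define $$\mathrm{Ob}_G(H)=H\cap\bigcap\{K\mid K \text{ open normal in } G,\ K\not\le H\},$$ $$\mathrm{Ob}^*_G(H)=H\cap\bigcap\{K\mid K \text{ open subgroup of } G,\ H\le N_G(K),\ K\not\le H\}.$$ Let $I^\lhd_n(G)$ be the intersection of all open normal subgroups of $G$ of index at most $n$. Put $\mathrm{OI}_n(G)=\mathrm{Ob}_G(I^\lhd_n(G))$, $\mathrm{OI}^*_n(G)=\mathrm{Ob}^*_G(I^\lhd_n(G))$, $\mathrm{ob}_G(n)=|G:\mathrm{OI}_n(G)|$ and $\mathrm{ob}^*_G(n)=|G:\mathrm{OI}^*_n(G)|$, with values in $\mathbb{N}\cup\{\infty\}$ (usual conventions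 for $\infty$). *)

theory Defs
  imports
    "HOL-Algebra.Group_Action"
    "HOL-Analysis.T1_Spaces"
    "HOL-Library.Extended_Nonnegative_Real"
begin

locale topological_group = group G for G :: "('a, 'b) monoid_scheme" (structure) +
  fixes T :: "'a topology"
  assumes topspace_eq: "topspace T = carrier G"
    and continuous_mult: "continuous_map (prod_topology T T) T (\<lambda>(x, y). x \<otimes> y)"
    and continuous_inv: "continuous_map T T (\<lambda>x. inv x)"

definition totally_disconnected_space :: "'a topology \<Rightarrow> bool" where
  "totally_disconnected_space T \<longleftrightarrow> (\<forall>S. connectedin T S \<longrightarrow> (\<exists>a. S \<subseteq> {a}))"

locale profinite_group = topological_group G T
  for G :: "('a, 'b) monoid_scheme" (structure) and T :: "'a topology" +
  assumes compact: "compact_space T"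
    and Hausdorff: "Hausdorff_space T"
    and totally_disconnected: "totally_disconnected_space T"

definition closed_subgroup :: "'a set \<Rightarrow> ('a, 'b) monoid_scheme \<Rightarrow> 'a topology \<Rightarrow> bool" where
  "closed_subgroup H G T \<longleftrightarrow> subgroup H G \<and> closedin T H"

definition open_subgroup :: "'a set \<Rightarrow> ('a, 'b) monoid_scheme \<Rightarrow> 'a topology \<Rightarrow> bool" where
  "open_subgroup H G T \<longleftrightarrow> subgroup H G \<and> openin T H"

definition open_normal :: "'a set \<Rightarrow> ('a, 'b) monoid_scheme \<Rightarrow> 'a topology \<Rightarrow> bool" where
  "open_normal N G T \<longleftrightarrow> N \<lhd> G \<and> openin T N"

definition subgroup_index :: "('a, 'b) monoid_scheme \<Rightarrow> 'a set \<Rightarrow> enat" where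
  "subgroup_index G H =
     (if finite (rcosets\<^bsub>G\<^esub> H) then enat (card (rcosets\<^bsub>G\<^esub> H)) else \<infinity>)"

definition normal_core :: "('a, 'b) monoid_scheme \<Rightarrow> 'a set \<Rightarrow> 'a set" where
  "normal_core G H = (\<Inter>g\<in>carrier G. g <#\<^bsub>G\<^esub> H #>\<^bsub>G\<^esub> inv\<^bsub>G\<^esub> g)"

locale just_infinite_profinite_group = profinite_group G T
  for G :: "('a, 'b) monoid_scheme" (structure) and T :: "'a topology" +
  assumes infinite_carrier: "infinite (carrier G)"
    and normal_finite_index:
      "\<lbrakk>N \<lhd> G; closedin T N; N \<noteq> {\<one>}\<rbrakk> \<Longrightarrow> subgroup_index G N \<noteq> \<infinity>"

definition Ob :: "('a, 'b) monoid_scheme \<Rightarrow> 'a topology \<Rightarrow> 'a set \<Rightarrow> 'a set" where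
  "Ob G T H = H \<inter> \<Inter>{K. open_normal K G T \<and> \<not> K \<subseteq> H}"

definition Ob_star :: "('a, 'b) monoid_scheme \<Rightarrow> 'a topology \<Rightarrow> 'a set \<Rightarrow> 'a set" where
  "Ob_star G T H =
     H \<inter> \<Inter>{K. open_subgroup K G T \<and> H \<subseteq> normalizer G K \<and> \<not> K \<subseteq> H}"

text \<open>For \<open>n \<ge> 1\<close> the family below contains \<open>carrier G\<close>; the explicit intersection
  with the carrier only matters for \<open>n = 0\<close>.\<close>

definition I_normal :: "('a, 'b) monoid_scheme \<Rightarrow> 'a topology \<Rightarrow> nat \<Rightarrow> 'a set" where
  "I_normal G T n =
     carrier G \<inter> \<Inter>{N. open_normal N G T \<and> subgroup_index G N \<le> enat n}"

definition OI :: "('a, 'b) monoid_scheme \<Rightarrow> 'a topology \<Rightarrow> nat \<Rightarrow> 'a set" where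
  "OI G T n = Ob G T (I_normal G T n)"

definition OI_star :: "('a, 'b) monoid_scheme \<Rightarrow> 'a topology \<Rightarrow> nat \<Rightarrow> 'a set" where
  "OI_star G T n = Ob_star G T (I_normal G T n)"

definition ob :: "('a, 'b) monoid_scheme \<Rightarrow> 'a topology \<Rightarrow> nat \<Rightarrow> enat" where
  "ob G T n = subgroup_index G (OI G T n)"

definition ob_star :: "('a, 'b) monoid_scheme \<Rightarrow> 'a topology \<Rightarrow> nat \<Rightarrow> enat" where
  "ob_star G T n = subgroup_index G (OI_star G T n)"

text \<open>The functions above for a subgroup \<open>H\<close> of \<open>G\<close>, regarded as a topological group
  in its own right with the subspace topology.\<close>

abbreviation ob_subgroup :: "('a, 'b) monoid_scheme \<Rightarrow> 'a topology \<Rightarrow> 'a set \<Rightarrow> nat \<Rightarrow> enat" where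
  "ob_subgroup G T H \<equiv> ob (G\<lparr>carrier := H\<rparr>) (subtopology T H)"

abbreviation ob_star_subgroup :: "('a, 'b) monoid_scheme \<Rightarrow> 'a topology \<Rightarrow> 'a set \<Rightarrow> nat \<Rightarrow> enat" where
  "ob_star_subgroup G T H \<equiv> ob_star (G\<lparr>carrier := H\<rparr>) (subtopology T H)"

definition subgroups_above :: "('a, 'b) monoid_scheme \<Rightarrow> 'a topology \<Rightarrow> nat \<Rightarrow> 'a set set" where
  "subgroups_above G T n = {L. closed_subgroup L G T \<and> I_normal G T n \<subseteq> L}"

end

theory Submission
  imports Defs "HOL-Algebra.Zassenhaus"
begin

text \<open>
  Each of the three inequalities follows from an inclusion between obliquity subgroups, together
  with multiplicativity of the index.

  The first rests on a finiteness property of a just infinite group \<open>G\<close>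
  (\<open>finite_open_normal_outside\<close>): only finitely many open normal subgroups are not contained in a
  given open neighbourhood \<open>U\<close> of the identity. By compactness, a strictly descending sequence of
  closed normal subgroups not contained in \<open>U\<close> has a nontrivial intersection; this has finite
  index, so the sequence is finite (\<open>wf_closed_normal_outside\<close>). The same principle shows that an open normal subgroup \<open>K\<close>
  has only finitely many maximal proper \<open>G\<close>-invariant open subgroups: if \<open>M0\<close> is one of them and
  \<open>C\<close> is a minimal closed normal subgroup of \<open>G\<close> with \<open>C \<subseteq> K\<close> and \<open>\<not> C \<subseteq> M0\<close>, then all of them
  contain the open subgroup \<open>C \<inter> M0\<close>. A finitely branching tree without infinite branches is
  finite. Applied with \<open>U = H\<close>, this gives \<open>OI\<^sub>n(H) \<subseteq> OI\<^sub>h\<^sub>n(G)\<close> as soon as \<open>n\<close> is at least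
  \<open>|H : H \<inter> K|\<close> for the finitely many open normal \<open>K\<close> not contained in \<open>H\<close>
  (\<open>OI_of_subgroup_eventually_subset\<close>).

  For the second, a normal subgroup \<open>N\<close> of \<open>H\<close> of index at most \<open>n\<close> has at most \<open>h\<close> conjugates in
  \<open>G\<close>, so its core has index at most \<open>t n\<^sup>h\<close> (\<open>subgroup_index_normal_core_le\<close>). Hence
  \<open>I\<^sub>m(G) \<subseteq> I\<^sub>n(H)\<close> for \<open>m = t n\<^sup>h\<close>, and the corresponding inclusion of \<open>OI\<^sup>*\<close> follows.

  For the third, an open subgroup \<open>K\<close> normalised by \<open>I\<^sub>n(G)\<close> is normal in \<open>L = N\<^sub>G(K)\<close>, which
  contains \<open>I\<^sub>n(G)\<close>; so the intersection of the groups \<open>OI\<^sub>n(L)\<close> lies in \<open>OI\<^sup>*\<^sub>n(G)\<close>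
  (\<open>Inter_OI_subset_OI_star\<close>). The product bounding its index is over a finite set, because
  \<open>I\<^sub>n(G)\<close> has finite index (\<open>I_normal_finite_index\<close>).
\<close>

section \<open>Index arithmetic\<close>

lemma ennreal_of_enat_mult:
  "ennreal_of_enat (a * b) = ennreal_of_enat a * ennreal_of_enat b"
  by (cases a; cases b)
    (auto simp: ennreal_mult_top ennreal_top_mult zero_enat_def times_enat_def)

lemma prod_enat_le_power:
  fixes f :: "'i \<Rightarrow> enat"
  assumes "finite I" "\<And>i. i \<in> I \<Longrightarrow> f i \<le> enat n"
  shows "prod f I \<le> enat (n ^ card I)"
  using assms
proof (induction I rule: finite_induct)
  case (insert i I)
  then have "f i * prod f I \<le> enat n * enat (n ^ card I)" by (intro mult_mono) auto
  then show ?case using insert by simp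
qed (simp add: one_enat_def)

lemma rcosets_subgroup_eq_image:
  "rcosets\<^bsub>G\<lparr>carrier := L\<rparr>\<^esub> K = (\<lambda>x. K #>\<^bsub>G\<^esub> x) ` L"
  by (auto simp: RCOSETS_def r_coset_def)

lemma rcosets_eq_image: "rcosets\<^bsub>G\<^esub> K = (\<lambda>x. K #>\<^bsub>G\<^esub> x) ` carrier G"
  by (auto simp: RCOSETS_def)

lemma subgroup_index_finite_iff: "subgroup_index G H \<noteq> \<infinity> \<longleftrightarrow> finite (rcosets\<^bsub>G\<^esub> H)"
  by (simp add: subgroup_index_def)

context group
begin

lemma subgroup_index_ge_1: "1 \<le> subgroup_index G H"
proof -
  have "rcosets H \<noteq> {}" by (auto simp: rcosets_eq_image)
  then have "finite (rcosets H) \<Longrightarrow> 1 \<le> card (rcosets H)"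
    by (simp add: Suc_leI card_gt_0_iff)
  then show ?thesis
    by (auto simp: subgroup_index_def one_enat_def)
qed

lemma subgroup_index_subgroup_ge_1:
  assumes "subgroup L G" shows "1 \<le> subgroup_index (G\<lparr>carrier := L\<rparr>) K"
  using group.subgroup_index_ge_1[OF subgroup_imp_group[OF assms]] .

lemma mult_inv_cancel_left:
  "x \<in> carrier G \<Longrightarrow> y \<in> carrier G \<Longrightarrow> x \<otimes> (inv x \<otimes> y) = y"
  by (simp flip: m_assoc)

lemma inv_mult_cancel_left:
  "x \<in> carrier G \<Longrightarrow> y \<in> carrier G \<Longrightarrow> inv x \<otimes> (x \<otimes> y) = y"
  by (simp flip: m_assoc)

lemma r_coset_eq_iff:
  assumes K: "subgroup K G" and x: "x \<in> carrier G" and y: "y \<in> carrier G"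
  shows "K #> x = K #> y \<longleftrightarrow> x \<otimes> inv y \<in> K"
proof
  assume "K #> x = K #> y"
  then have "x \<in> K #> y" using rcos_self[OF x K] by simp
  then show "x \<otimes> inv y \<in> K" by (rule subgroup.rcos_module_imp[OF K is_group y])
next
  assume "x \<otimes> inv y \<in> K"
  then have "x \<in> K #> y" by (rule subgroup.rcos_module_rev[OF K is_group y x])
  then show "K #> x = K #> y" using repr_independence[OF _ y K] by simp
qed

text \<open>A coset of \<open>K\<close> is obtained uniquely by translating a coset of \<open>K\<close> in \<open>H\<close> by the chosen
  representative of a coset of \<open>H\<close>.\<close>
lemma subgroup_index_mult:
  assumes H: "subgroup H G" and K: "subgroup K G" and KH: "K \<subseteq> H"
  shows "subgroup_index G K = subgroup_index G H * subgroup_index (G\<lparr>carrier := H\<rparr>) K"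
proof -
  define r where "r B = (SOME g. g \<in> B)" for B :: "'a set"
  define f where "f = (\<lambda>(B, A). A #> r B)"
  let ?R = "rcosets\<^bsub>G\<lparr>carrier := H\<rparr>\<^esub> K"
  have Hc: "H \<subseteq> carrier G" and Kc: "K \<subseteq> carrier G"
    using H K by (auto dest: subgroup.subset)
  have rB: "r B \<in> carrier G \<and> B = H #> r B" if "B \<in> rcosets H" for B
  proof -
    from that obtain x where x: "x \<in> carrier G" "B = H #> x" by (auto simp: rcosets_eq_image)
    then have "r B \<in> B" unfolding r_def using rcos_self[OF x(1) H] by (auto intro: someI)
    with x show ?thesis
      using repr_independence[OF _ x(1) H] r_coset_subset_G[OF Hc x(1)] by auto
  qed
  have f_eq: "f (B, K #> a) = K #> (a \<otimes> r B)" if "B \<in> rcosets H" "a \<in> H" for B a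
    unfolding f_def using rB[OF that(1)] that(2) Hc Kc by (auto simp: coset_mult_assoc)
  have "inj_on f ((rcosets H) \<times> ?R)"
  proof (rule inj_onI, clarify)
    fix B A B' A'
    assume B: "B \<in> rcosets H" and B': "B' \<in> rcosets H"
      and A: "A \<in> ?R" and A': "A' \<in> ?R" and eq: "f (B, A) = f (B', A')"
    from A A' obtain a a' where a: "a \<in> H" "A = K #> a" and a': "a' \<in> H" "A' = K #> a'"
      by (auto simp: rcosets_subgroup_eq_image)
    let ?x = "a \<otimes> r B" and ?y = "a' \<otimes> r B'"
    have xy: "?x \<in> carrier G" "?y \<in> carrier G" using a a' Hc rB[OF B] rB[OF B'] by auto
    have "K #> ?x = K #> ?y" using eq a a' B B' by (simp add: f_eq)
    then have "?x \<otimes> inv ?y \<in> H" using xy K KH r_coset_eq_iff by blast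
    then have "H #> ?x = H #> ?y" using xy H r_coset_eq_iff by blast
    moreover have "H #> ?x = B"
      using rB[OF B] a Hc H by (metis coset_join2 coset_mult_assoc subsetD)
    moreover have "H #> ?y = B'"
      using rB[OF B'] a' Hc H by (metis coset_join2 coset_mult_assoc subsetD)
    ultimately have BB: "B = B'" by simp
    have "A #> r B = A' #> r B" using eq by (simp add: f_def BB)
    moreover have "A \<subseteq> carrier G" "A' \<subseteq> carrier G" using a a' Hc Kc by (auto simp: r_coset_subset_G subsetD)
    ultimately have "A = A'"
      using rB[OF B] by (metis coset_mult_assoc coset_mult_one inv_closed r_inv)
    with BB show "B = B' \<and> A = A'" by simp
  qed
  moreover have "f ` ((rcosets H) \<times> ?R) = rcosets K"
  proof (intro equalityI subsetI)
    fix C assume "C \<in> f ` ((rcosets H) \<times> ?R)"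
    then obtain B a where "B \<in> rcosets H" "a \<in> H" "C = f (B, K #> a)"
      by (auto simp: rcosets_subgroup_eq_image)
    then show "C \<in> rcosets K"
      using rB Hc by (auto simp: f_eq rcosets_eq_image)
  next
    fix C assume "C \<in> rcosets K"
    then obtain x where x: "x \<in> carrier G" "C = K #> x" by (auto simp: rcosets_eq_image)
    let ?B = "H #> x"
    have B: "?B \<in> rcosets H" using x by (auto simp: rcosets_eq_image)
    then have "x \<in> H #> r ?B" using rB rcos_self[OF x(1) H] by auto
    then obtain a where a: "a \<in> H" "x = a \<otimes> r ?B" by (auto simp: r_coset_def)
    then have "C = f (?B, K #> a)" using x B by (simp add: f_eq)
    then show "C \<in> f ` ((rcosets H) \<times> ?R)" using B a by (auto simp: rcosets_subgroup_eq_image)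
  qed
  ultimately have bij: "bij_betw f ((rcosets H) \<times> ?R) (rcosets K)"
    by (simp add: bij_betw_def)
  have ne: "rcosets H \<noteq> {}" "?R \<noteq> {}"
    using subgroup.one_closed[OF H] by (auto simp: rcosets_eq_image rcosets_subgroup_eq_image)
  have "finite (rcosets K) \<longleftrightarrow> finite (rcosets H) \<and> finite ?R"
    using bij_betw_finite[OF bij] ne by (auto simp: finite_cartesian_product_iff)
  moreover have "card (rcosets K) = card (rcosets H) * card ?R"
    using bij_betw_same_card[OF bij] by (simp add: card_cartesian_product)
  moreover have "finite (rcosets H) \<Longrightarrow> card (rcosets H) \<noteq> 0" "finite ?R \<Longrightarrow> card ?R \<noteq> 0"
    using ne by auto
  ultimately show ?thesis
    by (auto simp: subgroup_index_def imult_is_infinity zero_enat_def)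
qed

lemma subgroup_index_antimono:
  assumes "subgroup H G" "subgroup K G" "K \<subseteq> H"
  shows "subgroup_index G H \<le> subgroup_index G K"
proof -
  have "subgroup_index G H * 1 \<le> subgroup_index G H * subgroup_index (G\<lparr>carrier := H\<rparr>) K"
    by (rule mult_left_mono[OF subgroup_index_subgroup_ge_1[OF assms(1)]]) simp
  then show ?thesis by (simp add: subgroup_index_mult[OF assms])
qed

lemma subgroup_index_le_1_imp_eq:
  assumes H: "subgroup H G" and K: "subgroup K G" and KH: "K \<subseteq> H"
    and le: "subgroup_index (G\<lparr>carrier := H\<rparr>) K \<le> 1"
  shows "H = K"
proof (intro equalityI subsetI)
  let ?R = "rcosets\<^bsub>G\<lparr>carrier := H\<rparr>\<^esub> K"
  fix x assume x: "x \<in> H"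
  have "finite ?R" "card ?R \<le> Suc 0"
    using le by (auto simp: subgroup_index_def one_enat_def split: if_splits)
  moreover have "K #> x \<in> ?R" "K #> \<one> \<in> ?R"
    using x subgroup.one_closed[OF H] by (auto simp: rcosets_subgroup_eq_image)
  ultimately have "K #> x = K #> \<one>" by (simp add: card_le_Suc0_iff_eq)
  then show "x \<in> K"
    using x H K by (simp add: r_coset_eq_iff subgroup.mem_carrier)
qed (use KH in blast)

text \<open>The cosets of \<open>A \<inter> B\<close> in \<open>A\<close> are the traces on \<open>A\<close> of cosets of \<open>B\<close>.\<close>
lemma subgroup_index_Int_le:
  assumes A: "subgroup A G" and B: "subgroup B G"
  shows "subgroup_index (G\<lparr>carrier := A\<rparr>) (A \<inter> B) \<le> subgroup_index G B"
proof -
  have "(A \<inter> B) #> a = A \<inter> (B #> a)" if a: "a \<in> A" for a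
  proof (intro equalityI subsetI)
    fix y assume y: "y \<in> A \<inter> (B #> a)"
    then obtain b where b: "b \<in> B" "y = b \<otimes> a" by (auto simp: r_coset_def)
    then have "b = y \<otimes> inv a"
      using a A B by (metis inv_solve_right subgroup.mem_carrier m_closed)
    then have "b \<in> A" using y a A by (simp add: subgroup.m_closed subgroup.m_inv_closed)
    then show "y \<in> (A \<inter> B) #> a" using b by (auto simp: r_coset_def)
  qed (use a A in \<open>auto simp: r_coset_def subgroup.m_closed\<close>)
  then have sub: "rcosets\<^bsub>G\<lparr>carrier := A\<rparr>\<^esub> (A \<inter> B) \<subseteq> (\<lambda>C. A \<inter> C) ` (rcosets B)"
    using subgroup.subset[OF A] by (auto simp: rcosets_subgroup_eq_image rcosets_eq_image)
  show ?thesis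
  proof (cases "finite (rcosets B)")
    case True
    then have "card (rcosets\<^bsub>G\<lparr>carrier := A\<rparr>\<^esub> (A \<inter> B)) \<le> card (rcosets B)"
      using sub by (meson card_image_le card_mono finite_imageI order_trans)
    then show ?thesis
      using True finite_subset[OF sub] by (auto simp: subgroup_index_def)
  qed (simp add: subgroup_index_def)
qed

lemma subgroup_index_Int_mult_le:
  assumes A: "subgroup A G" and B: "subgroup B G"
  shows "subgroup_index G (A \<inter> B) \<le> subgroup_index G A * subgroup_index G B"
  using subgroup_index_mult[OF A subgroups_Inter_pair[OF A B]] subgroup_index_Int_le[OF A B]
  by (simp add: mult_left_mono)

lemma subgroup_Int_Inter:
  assumes "subgroup A G" "\<And>B. B \<in> F \<Longrightarrow> subgroup B G"
  shows "subgroup (A \<inter> \<Inter>F) G"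
  using subgroups_Inter[of "insert A F"] assms by auto

lemma subgroup_index_Inter_le_prod:
  assumes "finite I" "\<And>i. i \<in> I \<Longrightarrow> subgroup (B i) G"
  shows "subgroup_index G (carrier G \<inter> (\<Inter>i\<in>I. B i)) \<le> (\<Prod>i\<in>I. subgroup_index G (B i))"
  using assms
proof (induction I rule: finite_induct)
  case empty
  have "rcosets (carrier G) = {carrier G}"
    by (auto simp: rcosets_eq_image coset_join2 subgroup_self intro!: exI[of _ \<one>])
  then show ?case by (simp add: subgroup_index_def one_enat_def)
next
  case (insert i I)
  let ?C = "carrier G \<inter> (\<Inter>i\<in>I. B i)"
  have C: "subgroup ?C G"
    using insert.prems by (intro subgroup_Int_Inter) (auto simp: subgroup_self)
  have i: "subgroup (B i) G" using insert.prems by auto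
  have "carrier G \<inter> (\<Inter>i\<in>insert i I. B i) = B i \<inter> ?C" by auto
  then have "subgroup_index G (carrier G \<inter> (\<Inter>i\<in>insert i I. B i))
      \<le> subgroup_index G (B i) * subgroup_index G ?C"
    using subgroup_index_Int_mult_le[OF i C] by simp
  also have "\<dots> \<le> subgroup_index G (B i) * (\<Prod>i\<in>I. subgroup_index G (B i))"
    using insert by (intro mult_left_mono) auto
  finally show ?case using insert by simp
qed

text \<open>An overgroup of \<open>C\<close> is the union of the cosets of \<open>C\<close> it contains.\<close>
lemma finite_supergroups:
  assumes C: "subgroup C G" and fin: "finite (rcosets C)"
  shows "finite {K. subgroup K G \<and> C \<subseteq> K}"
proof (rule finite_subset)
  show "{K. subgroup K G \<and> C \<subseteq> K} \<subseteq> Union ` Pow (rcosets C)"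
  proof clarify
    fix K assume K: "subgroup K G" "C \<subseteq> K"
    have "K = \<Union>((\<lambda>x. C #> x) ` K)"
    proof (intro equalityI subsetI)
      fix x assume "x \<in> K"
      then show "x \<in> \<Union>((\<lambda>x. C #> x) ` K)"
        using rcos_self[OF _ C] subgroup.mem_carrier[OF K(1)] by blast
    qed (use K subgroup.m_closed[OF K(1)] in \<open>auto simp: r_coset_def\<close>)
    moreover have "(\<lambda>x. C #> x) ` K \<in> Pow (rcosets C)"
      using subgroup.mem_carrier[OF K(1)] by (auto simp: rcosets_eq_image)
    ultimately show "K \<in> Union ` Pow (rcosets C)" by blast
  qed
qed (use fin in simp)

lemma card_rcosets_gt_0:
  "finite (rcosets K) \<Longrightarrow> 0 < card (rcosets K)"
  by (auto simp: card_gt_0_iff rcosets_eq_image)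

end

section \<open>Open and closed subgroups\<close>

context topological_group
begin

lemma openin_r_coset:
  assumes U: "openin T U" and a: "a \<in> carrier G"
  shows "openin T (U #> a)"
proof -
  have Uc: "U \<subseteq> carrier G" using openin_subset[OF U] topspace_eq by simp
  have "continuous_map T (prod_topology T T) (\<lambda>x. (x, inv a))"
    using a topspace_eq by (intro continuous_intros) simp_all
  from continuous_map_compose[OF this continuous_mult]
  have "continuous_map T T (\<lambda>x. x \<otimes> inv a)" by (simp add: o_def)
  from openin_continuous_map_preimage[OF this U]
  have "openin T {x \<in> carrier G. x \<otimes> inv a \<in> U}" by (simp add: topspace_eq)
  also have "{x \<in> carrier G. x \<otimes> inv a \<in> U} = U #> a"
  proof (intro equalityI subsetI)
    fix x assume x: "x \<in> {x \<in> carrier G. x \<otimes> inv a \<in> U}"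
    then have "x = (x \<otimes> inv a) \<otimes> a" using a by (simp add: m_assoc)
    then show "x \<in> U #> a" using x by (auto simp: r_coset_def)
  next
    fix x assume "x \<in> U #> a"
    then show "x \<in> {x \<in> carrier G. x \<otimes> inv a \<in> U}"
      using a Uc by (auto simp: r_coset_def m_assoc subsetD)
  qed
  finally show ?thesis .
qed

lemma openin_l_coset:
  assumes U: "openin T U" and a: "a \<in> carrier G"
  shows "openin T (a <# U)"
proof -
  have Uc: "U \<subseteq> carrier G" using openin_subset[OF U] topspace_eq by simp
  have "continuous_map T (prod_topology T T) (\<lambda>x. (inv a, x))"
    using a topspace_eq by (intro continuous_intros) simp_all
  from continuous_map_compose[OF this continuous_mult]
  have "continuous_map T T (\<lambda>x. inv a \<otimes> x)" by (simp add: o_def)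
  from openin_continuous_map_preimage[OF this U]
  have "openin T {x \<in> carrier G. inv a \<otimes> x \<in> U}" by (simp add: topspace_eq)
  also have "{x \<in> carrier G. inv a \<otimes> x \<in> U} = a <# U"
  proof (intro equalityI subsetI)
    fix x assume x: "x \<in> {x \<in> carrier G. inv a \<otimes> x \<in> U}"
    then have "x = a \<otimes> (inv a \<otimes> x)" using a by (simp flip: m_assoc)
    then show "x \<in> a <# U" using x by (auto simp: l_coset_def)
  next
    fix x assume "x \<in> a <# U"
    then show "x \<in> {x \<in> carrier G. inv a \<otimes> x \<in> U}"
      using a Uc by (auto simp: l_coset_def subsetD simp flip: m_assoc)
  qed
  finally show ?thesis .
qed

lemma closedin_r_coset:
  assumes C: "closedin T C" and a: "a \<in> carrier G"
  shows "closedin T (C #> a)"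
proof -
  have Cc: "C \<subseteq> carrier G" using closedin_subset[OF C] topspace_eq by simp
  have "openin T ((carrier G - C) #> a)"
    using C by (intro openin_r_coset a) (simp add: closedin_def topspace_eq)
  also have "(carrier G - C) #> a = carrier G - (C #> a)"
  proof (intro equalityI subsetI)
    fix x assume x: "x \<in> carrier G - (C #> a)"
    then have xa: "x = (x \<otimes> inv a) \<otimes> a" using a by (simp add: m_assoc)
    then have "x \<otimes> inv a \<notin> C" using x by (auto simp: r_coset_def)
    then have "x \<otimes> inv a \<in> carrier G - C" using x a by simp
    with xa show "x \<in> (carrier G - C) #> a" by (auto simp: r_coset_def)
  qed (use a Cc in \<open>auto simp: r_coset_def subsetD\<close>)
  finally show ?thesis
    using r_coset_subset_G[OF Cc a] by (simp add: closedin_def topspace_eq)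
qed

lemma openin_supergroup:
  assumes K: "subgroup K G" "openin T K" and L: "subgroup L G" "K \<subseteq> L"
  shows "openin T L"
proof -
  have "L = (\<Union>x\<in>L. K #> x)"
  proof (intro equalityI subsetI)
    fix x assume "x \<in> L"
    then show "x \<in> (\<Union>x\<in>L. K #> x)"
      using rcos_self[OF _ K(1)] subgroup.mem_carrier[OF L(1)] by blast
  qed (use L subgroup.m_closed[OF L(1)] in \<open>auto simp: r_coset_def\<close>)
  moreover have "openin T (\<Union>x\<in>L. K #> x)"
    using K subgroup.mem_carrier[OF L(1)] by (auto intro!: openin_r_coset)
  ultimately show ?thesis by simp
qed

lemma complement_eq_Union_rcosets:
  assumes K: "subgroup K G"
  shows "carrier G - K = \<Union>(rcosets K - {K})"
proof -
  have KR: "K \<in> rcosets K"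
    using coset_join2[OF one_closed K subgroup.one_closed[OF K]] by (force simp: rcosets_eq_image)
  have "C \<inter> K = {}" if "C \<in> rcosets K - {K}" for C
    using rcos_disjoint[OF K] that KR by (auto simp: pairwise_def disjnt_def)
  then have "\<Union>(rcosets K - {K}) = \<Union>(rcosets K) - K" by fastforce
  then show ?thesis by (simp add: rcosets_part_G[OF K])
qed

lemma open_subgroup_closedin:
  assumes K: "subgroup K G" "openin T K"
  shows "closedin T K"
proof -
  have "openin T (\<Union>(rcosets K - {K}))"
    using K by (auto simp: rcosets_eq_image intro!: openin_r_coset)
  then show ?thesis
    using subgroup.subset[OF K(1)]
    by (simp add: closedin_def topspace_eq complement_eq_Union_rcosets[OF K(1)])
qed

lemma closed_finite_index_openin:
  assumes K: "subgroup K G" "closedin T K" and fin: "finite (rcosets K)"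
  shows "openin T K"
proof -
  have "closedin T (\<Union>(rcosets K - {K}))"
    using K fin by (intro closedin_Union) (auto simp: rcosets_eq_image intro!: closedin_r_coset)
  then have "openin T (carrier G - (carrier G - K))"
    by (simp add: closedin_def topspace_eq complement_eq_Union_rcosets[OF K(1)])
  then show ?thesis
    using subgroup.subset[OF K(1)] by (simp add: double_diff)
qed

lemma open_normal_Int:
  assumes "open_normal M G T" "open_normal N G T"
  shows "open_normal (M \<inter> N) G T"
  using assms by (simp add: open_normal_def normal_subgroup_intersect openin_Int)

lemma open_normal_subgroup: "open_normal N G T \<Longrightarrow> subgroup N G"
  by (simp add: open_normal_def normal_imp_subgroup)

lemma open_normal_carrier: "open_normal (carrier G) G T"
  using openin_topspace[of T]
  by (auto simp: open_normal_def topspace_eq intro!: normal_invI subgroup_self)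

lemma open_normal_Int_subgroup:
  assumes "open_normal N G T" and H: "subgroup H G"
  shows "open_normal (H \<inter> N) (G\<lparr>carrier := H\<rparr>) (subtopology T H)"
proof -
  have "N \<inter> H \<lhd> G\<lparr>carrier := H\<rparr>" "openin (subtopology T H) (N \<inter> H)"
    using assms normal_Int_subgroup[OF H] by (simp_all add: open_normal_def openin_subtopology_Int)
  then show ?thesis by (simp add: open_normal_def Int_commute)
qed

end

context profinite_group
begin

lemma open_subgroup_finite_index:
  assumes K: "subgroup K G" "openin T K"
  shows "finite (rcosets K)"
proof -
  have op: "\<And>C. C \<in> rcosets K \<Longrightarrow> openin T C"
    using K by (auto simp: rcosets_eq_image intro!: openin_r_coset)
  obtain F where F: "finite F" "F \<subseteq> rcosets K" "\<Union>F = carrier G"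
    using compact op rcosets_part_G[OF K(1)] topspace_eq
    unfolding compact_space by metis
  have "C \<in> F" if C: "C \<in> rcosets K" for C
  proof -
    obtain x where x: "x \<in> C" "x \<in> carrier G"
      using subgroup.rcosets_non_empty[OF K(1) C] subgroup.rcosets_carrier[OF K(1) is_group C] by blast
    then obtain D where "D \<in> F" "x \<in> D" using F(3) by blast
    then show ?thesis
      using rcos_disjoint[OF K(1)] C F(2) x by (metis disjnt_iff pairwiseD subsetD)
  qed
  then show ?thesis using finite_subset[OF _ F(1)] by (simp add: subsetI)
qed

end

section \<open>Just infinite groups have few open normal subgroups outside an open set\<close>

context just_infinite_profinite_group
begin

lemma normal_finite_rcosets:
  assumes "N \<lhd> G" "closedin T N" "N \<noteq> {\<one>}" shows "finite (rcosets N)"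
  using normal_finite_index[OF assms] by (simp only: subgroup_index_finite_iff)

lemma normal_openin:
  assumes "N \<lhd> G" "closedin T N" "N \<noteq> {\<one>}" shows "openin T N"
  using closed_finite_index_openin normal_finite_rcosets assms normal_imp_subgroup by blast

lemma one_infinite_index: "infinite (rcosets {\<one>})"
proof
  assume "finite (rcosets {\<one>})"
  moreover have "finite C" if "C \<in> rcosets {\<one>}" for C
    using that by (auto simp: rcosets_eq_image r_coset_def)
  ultimately show False
    using infinite_carrier rcosets_part_G[OF triv_subgroup] by (metis finite_Union)
qed

text \<open>A strictly descending sequence of closed normal subgroups that all leave the neighbourhood
  \<open>U\<close> of the identity would, by compactness, have a nontrivial intersection, which has finite
  index and therefore only finitely many overgroups.\<close>
lemma wf_closed_normal_outside:
  assumes U: "openin T U" and one: "\<one> \<in> U"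
  shows "wf {(A, B). A \<subset> B \<and> A \<lhd> G \<and> closedin T A \<and> \<not> A \<subseteq> U}"
  unfolding wf_iff_no_infinite_down_chain
proof
  assume "\<exists>f. \<forall>i. (f (Suc i), f i) \<in> {(A, B). A \<subset> B \<and> A \<lhd> G \<and> closedin T A \<and> \<not> A \<subseteq> U}"
  then obtain f :: "nat \<Rightarrow> 'a set" where
    "\<forall>i. (f (Suc i), f i) \<in> {(A, B). A \<subset> B \<and> A \<lhd> G \<and> closedin T A \<and> \<not> A \<subseteq> U}" ..
  note f = this[rule_format]
  \<comment> \<open>The relation constrains only the smaller of two groups, so the sequence is shifted by one.\<close>
  define g where "g i = f (Suc i)" for i
  have "g (Suc i) \<subset> g i \<and> g i \<lhd> G \<and> closedin T (g i) \<and> \<not> g i \<subseteq> U" for i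
    using f[of i] f[of "Suc i"] by (simp add: g_def)
  then have g: "\<And>i. g (Suc i) \<subset> g i" "\<And>i. g i \<lhd> G" "\<And>i. closedin T (g i)" "\<And>i. \<not> g i \<subseteq> U"
    by simp_all
  have dec: "g j \<subseteq> g i" if "i \<le> j" for i j
    using lift_Suc_antimono_le[of g] g(1) that by blast
  have sdec: "g j \<subset> g i" if "i < j" for i j
    using dec[of "Suc i" j] g(1)[of i] that by auto
  define C where "C = (\<Inter>i. g i)"
  have Cn: "C \<lhd> G"
    unfolding normal_inv_iff
  proof
    show "subgroup C G" unfolding C_def
      using g(2) by (intro subgroups_Inter) (auto intro: normal_imp_subgroup)
    show "\<forall>x\<in>carrier G. \<forall>h\<in>C. x \<otimes> h \<otimes> inv x \<in> C"
      using g(2) by (auto simp: C_def normal_inv_iff)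
  qed
  have Cc: "closedin T C" unfolding C_def using g(3) by (intro closedin_Inter) auto
  have "(\<Inter>i. g i - U) \<noteq> {}"
  proof (rule compact_space_imp_nest[OF compact])
    show "closedin T (g n - U)" for n using g(3) U by (rule closedin_diff)
    show "g n - U \<noteq> {}" for n using g(4) by blast
    show "decseq (\<lambda>i. g i - U)" using dec by (auto simp: decseq_def)
  qed
  then have "C \<noteq> {\<one>}" using one by (auto simp: C_def)
  then have "finite {K. subgroup K G \<and> C \<subseteq> K}"
    using finite_supergroups normal_finite_rcosets Cn Cc normal_imp_subgroup by blast
  moreover have "range g \<subseteq> {K. subgroup K G \<and> C \<subseteq> K}"
    using g(2) by (auto simp: C_def intro: normal_imp_subgroup)
  ultimately have "finite (range g)" by (rule rev_finite_subset)
  moreover have "inj g"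
    by (rule linorder_injI) (use sdec in blast)
  ultimately show False using finite_imageD by blast
qed

text \<open>The maximal elements among the open normal subgroups of \<open>G\<close> properly contained in \<open>K\<close>.\<close>
definition maximal_open_normal_below :: "'a set \<Rightarrow> 'a set set" where
  "maximal_open_normal_below K = {M. open_normal M G T \<and> M \<subset> K \<and>
     (\<forall>X. open_normal X G T \<longrightarrow> M \<subset> X \<longrightarrow> X \<subseteq> K \<longrightarrow> X = K)}"

lemma open_normal_ne_one:
  assumes "open_normal N G T" shows "N \<noteq> {\<one>}"
  using open_subgroup_finite_index one_infinite_index assms
  by (auto simp: open_normal_def normal_imp_subgroup)

lemma finite_open_normal_above:
  assumes "open_normal N G T" shows "finite {X. open_normal X G T \<and> N \<subseteq> X}"
  by (rule finite_subset[OF _ finite_supergroups[of N]])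
    (use assms open_subgroup_finite_index in
      \<open>auto simp: open_normal_def normal_imp_subgroup\<close>)

lemma open_normal_set_mult:
  assumes M: "open_normal M G T" and B: "open_normal B G T"
  shows "open_normal (M <#> B) G T" "M \<subseteq> M <#> B" "B \<subseteq> M <#> B"
proof -
  have n: "M \<lhd> G" "B \<lhd> G" and s: "subgroup M G" "subgroup B G"
    using M B by (auto simp: open_normal_def normal_imp_subgroup)
  show sub: "M \<subseteq> M <#> B"
    using subgroup.one_closed[OF s(2)] subgroup.mem_carrier[OF s(1)]
    by (force simp: set_mult_def)
  show "B \<subseteq> M <#> B"
    using subgroup.one_closed[OF s(1)] subgroup.mem_carrier[OF s(2)]
    by (force simp: set_mult_def)
  have sg: "subgroup (M <#> B) G"
    by (rule mult_norm_subgroup[OF n(1) s(2)])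
  have "M <#> B \<lhd> G"
  proof (rule normal_invI[OF sg])
    fix x h assume x: "x \<in> carrier G" and "h \<in> M <#> B"
    then obtain m b where mb: "m \<in> M" "b \<in> B" "h = m \<otimes> b" by (auto simp: set_mult_def)
    then have c: "m \<in> carrier G" "b \<in> carrier G" using s by (auto intro: subgroup.mem_carrier)
    have "x \<otimes> h \<otimes> inv x = (x \<otimes> m \<otimes> inv x) \<otimes> (x \<otimes> b \<otimes> inv x)"
      using x c mb(3) by (simp add: m_assoc mult_inv_cancel_left inv_mult_cancel_left)
    moreover have "x \<otimes> m \<otimes> inv x \<in> M" "x \<otimes> b \<otimes> inv x \<in> B"
      using n x mb by (auto simp: normal_inv_iff)
    ultimately show "x \<otimes> h \<otimes> inv x \<in> M <#> B" by (auto simp: set_mult_def)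
  qed
  then show "open_normal (M <#> B) G T"
    using openin_supergroup[OF s(1) _ sg sub] M by (simp add: open_normal_def)
qed

text \<open>Fix one maximal subgroup \<open>M0\<close> below \<open>K\<close> and let \<open>C\<close> be a closed normal subgroup in \<open>K\<close> minimal
  with \<open>C \<not>\<subseteq> M0\<close>. Then \<open>C \<inter> M0\<close> is open, and it lies in every other maximal subgroup below \<open>K\<close>.\<close>
lemma finite_maximal_open_normal_below:
  assumes K: "open_normal K G T"
  shows "finite (maximal_open_normal_below K)"
proof (cases "maximal_open_normal_below K = {}")
  case False
  then obtain M0 where M0: "open_normal M0 G T" "M0 \<subset> K"
    by (auto simp: maximal_open_normal_below_def)
  let ?F = "{C. C \<lhd> G \<and> closedin T C \<and> C \<subseteq> K \<and> \<not> C \<subseteq> M0}"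
  have "K \<in> ?F"
    using K M0 open_subgroup_closedin by (auto simp: open_normal_def normal_imp_subgroup)
  moreover have "wf {(A, B). A \<subset> B \<and> A \<lhd> G \<and> closedin T A \<and> \<not> A \<subseteq> M0}"
    using M0 subgroup.one_closed[OF open_normal_subgroup]
    by (intro wf_closed_normal_outside) (auto simp: open_normal_def)
  ultimately obtain C where C: "C \<in> ?F"
    and min: "\<And>D. (D, C) \<in> {(A, B). A \<subset> B \<and> A \<lhd> G \<and> closedin T A \<and> \<not> A \<subseteq> M0} \<Longrightarrow> D \<notin> ?F"
    by (metis (no_types, lifting) wfE_min)
  have "C \<noteq> {\<one>}" using C subgroup.one_closed[OF open_normal_subgroup[OF M0(1)]] by auto
  then have Co: "open_normal C G T" using C normal_openin by (auto simp: open_normal_def)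
  define B where "B = C \<inter> M0"
  have B: "open_normal B G T" using open_normal_Int[OF Co M0(1)] by (simp add: B_def)
  have "B \<subseteq> M" if M: "M \<in> maximal_open_normal_below K" for M
  proof (rule ccontr)
    assume nB: "\<not> B \<subseteq> M"
    have Mo: "open_normal M G T" and MK: "M \<subset> K"
      and Mmax: "\<And>X. open_normal X G T \<Longrightarrow> M \<subset> X \<Longrightarrow> X \<subseteq> K \<Longrightarrow> X = K"
      using M by (auto simp: maximal_open_normal_below_def)
    note s = open_normal_subgroup[OF Mo] open_normal_subgroup[OF B] open_normal_subgroup[OF Co]
      open_normal_subgroup[OF M0(1)] open_normal_subgroup[OF K]
    have "M <#> B \<subseteq> K"
      using MK M0 s by (auto simp: set_mult_def B_def intro!: subgroup.m_closed[OF s(5)])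
    moreover have "M \<subset> M <#> B" using open_normal_set_mult(2,3)[OF Mo B] nB by blast
    ultimately have MB: "M <#> B = K" using Mmax open_normal_set_mult(1)[OF Mo B] by blast
    \<comment> \<open>\<open>C \<inter> M\<close> is a proper subgroup of \<open>C\<close>, so minimality of \<open>C\<close> applies to it.\<close>
    have CM: "C \<inter> M \<subseteq> M0"
    proof (rule ccontr)
      assume n: "\<not> C \<inter> M \<subseteq> M0"
      have CMo: "open_normal (C \<inter> M) G T" using open_normal_Int[OF Co Mo] .
      moreover have "closedin T (C \<inter> M)"
        using CMo open_subgroup_closedin open_normal_subgroup by (auto simp: open_normal_def)
      moreover have "C \<inter> M \<subset> C" using nB by (auto simp: B_def)
      ultimately show False
        using min[of "C \<inter> M"] C n by (auto simp: open_normal_def)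
    qed
    have "C \<subseteq> M0"
    proof
      fix c assume c: "c \<in> C"
      then have "c \<in> M <#> B" using C MB by auto
      then obtain m b where mb: "m \<in> M" "b \<in> B" "c = m \<otimes> b" by (auto simp: set_mult_def)
      then have bc: "b \<in> C" "b \<in> M0" by (auto simp: B_def)
      have "m = c \<otimes> inv b"
        using mb s subgroup.mem_carrier by (metis inv_solve_right subgroup.mem_carrier m_closed)
      then have "m \<in> C" using c bc s(3) by (simp add: subgroup.m_closed subgroup.m_inv_closed)
      then have "m \<in> M0" using CM mb by blast
      then show "c \<in> M0" using bc mb s(4) by (simp add: subgroup.m_closed)
    qed
    then show False using C by blast
  qed
  then have "maximal_open_normal_below K \<subseteq> {X. open_normal X G T \<and> B \<subseteq> X}"
    by (auto simp: maximal_open_normal_below_def)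
  then show ?thesis using finite_open_normal_above[OF B] finite_subset by blast
qed simp

lemma ex_maximal_open_normal_below:
  assumes K: "open_normal K G T" and X: "open_normal X G T" "X \<subset> K"
  shows "\<exists>M \<in> maximal_open_normal_below K. X \<subseteq> M"
proof -
  let ?A = "{Y. open_normal Y G T \<and> X \<subseteq> Y} \<inter> {Y. Y \<subset> K}"
  have "finite ?A" using finite_open_normal_above[OF X(1)] by simp
  moreover have "X \<in> ?A" using X by simp
  ultimately have "\<exists>M\<in>?A. X \<subseteq> M \<and> (\<forall>Y\<in>?A. M \<subseteq> Y \<longrightarrow> M = Y)"
    by (rule finite_has_maximal2)
  then obtain M where M: "M \<in> ?A" "X \<subseteq> M" "\<forall>Y\<in>?A. M \<subseteq> Y \<longrightarrow> M = Y"
    by (elim bexE conjE)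
  have "Y = K" if "open_normal Y G T" "M \<subset> Y" "Y \<subseteq> K" for Y
    using M(3) that M(2) by auto
  then have "M \<in> maximal_open_normal_below K"
    using M(1) by (auto simp: maximal_open_normal_below_def)
  then show ?thesis using M(2) by blast
qed

text \<open>Every open normal subgroup properly contained in \<open>K\<close> lies in one of the finitely many maximal
  ones, and descending from \<open>G\<close> along maximal ones that leave \<open>U\<close> terminates; the resulting tree
  is finitely branching without infinite branches, hence finite.\<close>
theorem finite_open_normal_outside:
  assumes U: "openin T U" and one: "\<one> \<in> U"
  shows "finite {K. open_normal K G T \<and> \<not> K \<subseteq> U}"
proof -
  let ?N = "\<lambda>K. {X. open_normal X G T \<and> \<not> X \<subseteq> U \<and> X \<subseteq> K}"
  have "open_normal K G T \<Longrightarrow> finite (?N K)" for K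
  proof (induction K rule: wf_induct_rule[OF wf_closed_normal_outside[OF U one]])
    case (1 K)
    have "finite (?N M)" if M: "M \<in> maximal_open_normal_below K" for M
    proof (cases "M \<subseteq> U")
      case False
      have Mo: "open_normal M G T" "M \<subset> K" using M by (auto simp: maximal_open_normal_below_def)
      then show ?thesis
        using "1.IH"[of M] False open_subgroup_closedin[of M]
        by (auto simp: open_normal_def normal_imp_subgroup)
    next
      case True
      then have "?N M = {}" by blast
      then show ?thesis by (simp only: finite.emptyI)
    qed
    then have "finite (insert K (\<Union>M\<in>maximal_open_normal_below K. ?N M))"
      using finite_maximal_open_normal_below[OF 1(2)] by blast
    moreover have "?N K \<subseteq> insert K (\<Union>M\<in>maximal_open_normal_below K. ?N M)"
    proof
      fix X assume X: "X \<in> ?N K"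
      show "X \<in> insert K (\<Union>M\<in>maximal_open_normal_below K. ?N M)"
      proof (cases "X = K")
        case False
        then obtain M where "M \<in> maximal_open_normal_below K" "X \<subseteq> M"
          using ex_maximal_open_normal_below[OF 1(2), of X] X by auto
        then show ?thesis using X by auto
      qed simp
    qed
    ultimately show ?case by (rule rev_finite_subset)
  qed
  from this[OF open_normal_carrier]
  show ?thesis
    by (rule rev_finite_subset) (auto dest: open_normal_subgroup subgroup.subset)
qed

end

section \<open>Obliquity subgroups and passage to subgroups\<close>

context group
begin

lemma Ob_subgroup: "subgroup A G \<Longrightarrow> subgroup (Ob G T A) G"
  unfolding Ob_def
  by (rule subgroup_Int_Inter) (auto simp: open_normal_def normal_imp_subgroup)

lemma Ob_star_subgroup: "subgroup A G \<Longrightarrow> subgroup (Ob_star G T A) G"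
  unfolding Ob_star_def
  by (rule subgroup_Int_Inter) (auto simp: open_subgroup_def)

lemma I_normal_subgroup: "subgroup (I_normal G T n) G"
  unfolding I_normal_def
  by (rule subgroup_Int_Inter) (auto simp: open_normal_def normal_imp_subgroup subgroup_self)

lemma OI_subgroup: "subgroup (OI G T n) G"
  unfolding OI_def by (intro Ob_subgroup I_normal_subgroup)

lemma OI_star_subgroup: "subgroup (OI_star G T n) G"
  unfolding OI_star_def by (intro Ob_star_subgroup I_normal_subgroup)

lemma I_normal_normal: "I_normal G T n \<lhd> G"
  unfolding normal_inv_iff
proof
  show "\<forall>x\<in>carrier G. \<forall>h\<in>I_normal G T n. x \<otimes> h \<otimes> inv x \<in> I_normal G T n"
    by (auto simp: I_normal_def open_normal_def normal_inv_iff)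
qed (rule I_normal_subgroup)

lemma OI_of_subgroup:
  assumes L: "subgroup L G"
  shows "subgroup (OI (G\<lparr>carrier := L\<rparr>) U n) G" "OI (G\<lparr>carrier := L\<rparr>) U n \<subseteq> L"
proof -
  have "subgroup (OI (G\<lparr>carrier := L\<rparr>) U n) (G\<lparr>carrier := L\<rparr>)"
    by (rule group.OI_subgroup[OF subgroup_imp_group[OF L]])
  then show "subgroup (OI (G\<lparr>carrier := L\<rparr>) U n) G" "OI (G\<lparr>carrier := L\<rparr>) U n \<subseteq> L"
    using incl_subgroup[OF L] subgroup.subset by fastforce+
qed

lemma OI_star_of_subgroup:
  assumes L: "subgroup L G"
  shows "subgroup (OI_star (G\<lparr>carrier := L\<rparr>) U n) G" "OI_star (G\<lparr>carrier := L\<rparr>) U n \<subseteq> L"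
proof -
  have "subgroup (OI_star (G\<lparr>carrier := L\<rparr>) U n) (G\<lparr>carrier := L\<rparr>)"
    by (rule group.OI_star_subgroup[OF subgroup_imp_group[OF L]])
  then show "subgroup (OI_star (G\<lparr>carrier := L\<rparr>) U n) G" "OI_star (G\<lparr>carrier := L\<rparr>) U n \<subseteq> L"
    using incl_subgroup[OF L] subgroup.subset by fastforce+
qed

lemma subgroup_index_OI_of_subgroup:
  assumes L: "subgroup L G"
  shows "subgroup_index G (OI (G\<lparr>carrier := L\<rparr>) U n) = subgroup_index G L * ob (G\<lparr>carrier := L\<rparr>) U n"
  unfolding ob_def using OI_of_subgroup[OF L] by (intro subgroup_index_mult L)

lemma subgroup_index_OI_star_of_subgroup:
  assumes L: "subgroup L G"
  shows "subgroup_index G (OI_star (G\<lparr>carrier := L\<rparr>) U n)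
    = subgroup_index G L * ob_star (G\<lparr>carrier := L\<rparr>) U n"
  unfolding ob_star_def using OI_star_of_subgroup[OF L] by (intro subgroup_index_mult L)

lemma mem_normalizer_subgroup:
  assumes L: "subgroup L G" and K: "K \<subseteq> L" and g: "g \<in> normalizer (G\<lparr>carrier := L\<rparr>) K"
  shows "g \<in> normalizer G K"
proof -
  have "g \<in> L" "g <# K #> inv\<^bsub>G\<lparr>carrier := L\<rparr>\<^esub> g = K"
    using g K by (auto simp: normalizer_def stabilizer_def l_coset_def r_coset_def)
  then show ?thesis
    using K L subgroup.subset[OF L] by (auto simp: normalizer_def stabilizer_def)
qed

end

context topological_group
begin

lemma I_normal_subset_if_index_le:
  assumes "open_normal N G T" "subgroup_index G N \<le> enat n"
  shows "I_normal G T n \<subseteq> N"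
  using assms by (auto simp: I_normal_def)

lemma I_normal_of_subgroup_subset:
  assumes L: "subgroup L G" and N: "open_normal N G T"
    and ind: "subgroup_index (G\<lparr>carrier := L\<rparr>) (L \<inter> N) \<le> enat n"
  shows "I_normal (G\<lparr>carrier := L\<rparr>) (subtopology T L) n \<subseteq> N"
  using open_normal_Int_subgroup[OF N L] ind by (auto simp: I_normal_def)

lemma I_normal_of_subgroup_mono:
  assumes L: "subgroup L G"
  shows "I_normal (G\<lparr>carrier := L\<rparr>) (subtopology T L) n \<subseteq> I_normal G T n"
proof -
  have "I_normal (G\<lparr>carrier := L\<rparr>) (subtopology T L) n \<subseteq> N"
    if "open_normal N G T" "subgroup_index G N \<le> enat n" for N
    using that subgroup_index_Int_le[OF L open_normal_subgroup]
    by (intro I_normal_of_subgroup_subset[OF L]) (auto intro: order_trans)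
  moreover have "I_normal (G\<lparr>carrier := L\<rparr>) (subtopology T L) n \<subseteq> carrier G"
    using subgroup.subset[OF L] by (auto simp: I_normal_def)
  ultimately show ?thesis unfolding I_normal_def[of G] by blast
qed

end

section \<open>Bounding obliquity from below on a subgroup\<close>

context just_infinite_profinite_group
begin

text \<open>Only finitely many open normal subgroups \<open>K\<close> of \<open>G\<close> are not contained in \<open>H\<close>; once \<open>n\<close> exceeds
  each \<open>|H : H \<inter> K|\<close>, these subgroups do no harm, and the remaining ones lie in \<open>H\<close>, where
  \<open>|G : K| = h |H : K|\<close>.\<close>
lemma OI_of_subgroup_eventually_subset:
  assumes H: "subgroup H G" "openin T H" and h: "subgroup_index G H = enat h"
  shows "\<forall>\<^sub>F n in sequentially.
    OI (G\<lparr>carrier := H\<rparr>) (subtopology T H) n \<subseteq> OI G T (h * n)"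
proof -
  let ?H = "G\<lparr>carrier := H\<rparr>" and ?T = "subtopology T H"
  define F where "F = {K. open_normal K G T \<and> \<not> K \<subseteq> H}"
  have F: "finite F"
    unfolding F_def by (intro finite_open_normal_outside H subgroup.one_closed)
  define n0 where "n0 = (\<Sum>K\<in>F. card (rcosets\<^bsub>?H\<^esub> (H \<inter> K)))"
  have h0: "0 < h"
    using subgroup_index_ge_1[of H] by (simp add: h one_enat_def)
  show ?thesis
  proof (rule eventually_sequentiallyI[of n0])
    fix n assume n: "n0 \<le> n"
    let ?I = "I_normal ?H ?T n"
    \<comment> \<open>\<open>n0\<close> is at least \<open>|H : H \<inter> K|\<close> for each \<open>K\<close> not contained in \<open>H\<close>.\<close>
    have out: "?I \<subseteq> K" if K: "open_normal K G T" "\<not> K \<subseteq> H" for K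
    proof (rule I_normal_of_subgroup_subset[OF H(1) K(1)])
      have "finite (rcosets K)"
        using K open_subgroup_finite_index open_normal_subgroup by (auto simp: open_normal_def)
      then have "subgroup_index ?H (H \<inter> K) \<noteq> \<infinity>"
        using subgroup_index_Int_le[OF H(1) open_normal_subgroup[OF K(1)]]
        by (auto simp: subgroup_index_def split: if_splits)
      then have "subgroup_index ?H (H \<inter> K) = enat (card (rcosets\<^bsub>?H\<^esub> (H \<inter> K)))"
        by (simp add: subgroup_index_def split: if_splits)
      moreover have "card (rcosets\<^bsub>?H\<^esub> (H \<inter> K)) \<le> n0"
        unfolding n0_def using K F by (intro member_le_sum) (auto simp: F_def)
      ultimately show "subgroup_index ?H (H \<inter> K) \<le> enat n" using n by simp
    qed
    have inn: "open_normal K ?H ?T" if K: "open_normal K G T" "K \<subseteq> H" for K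
      using open_normal_Int_subgroup[OF K(1) H(1)] K(2) by (simp add: Int_absorb1)
    have "?I \<subseteq> N" if N: "open_normal N G T" "subgroup_index G N \<le> enat (h * n)" for N
    proof (cases "N \<subseteq> H")
      case True
      have "enat h * subgroup_index ?H N \<le> enat (h * n)"
        using subgroup_index_mult[OF H(1) open_normal_subgroup[OF N(1)] True] N(2) h by simp
      then have "subgroup_index ?H N \<le> enat n"
        using h0 by (cases "subgroup_index ?H N") (auto simp: zero_enat_def)
      then show ?thesis using inn[OF N(1) True] by (auto simp: I_normal_def)
    qed (use out N in blast)
    moreover have "?I \<subseteq> carrier G"
      using subgroup.subset[OF H(1)] by (auto simp: I_normal_def)
    ultimately have II: "?I \<subseteq> I_normal G T (h * n)"
      unfolding I_normal_def[of G] by blast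
    have "OI ?H ?T n \<subseteq> K" if K: "open_normal K G T" "\<not> K \<subseteq> I_normal G T (h * n)" for K
    proof (cases "K \<subseteq> H")
      case True
      then have "open_normal K ?H ?T" "\<not> K \<subseteq> ?I" using inn K II by auto
      then show ?thesis by (auto simp: OI_def Ob_def)
    next
      case False
      then show ?thesis using out[OF K(1)] by (auto simp: OI_def Ob_def)
    qed
    moreover have "OI ?H ?T n \<subseteq> I_normal G T (h * n)"
      using II by (auto simp: OI_def Ob_def)
    ultimately show "OI ?H ?T n \<subseteq> OI G T (h * n)"
      unfolding OI_def[of G] Ob_def[of G] by blast
  qed
qed

end

section \<open>Normal cores\<close>

context group
begin

lemma mem_conjugate_iff:
  assumes "N \<subseteq> carrier G" "g \<in> carrier G"
  shows "y \<in> g <# N #> inv g \<longleftrightarrow> y \<in> carrier G \<and> inv g \<otimes> y \<otimes> g \<in> N"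
proof
  assume "y \<in> g <# N #> inv g"
  then obtain x where x: "x \<in> N" "y = g \<otimes> x \<otimes> inv g"
    by (auto simp: l_coset_def r_coset_def)
  then have "inv g \<otimes> y \<otimes> g = x"
    using assms by (simp add: m_assoc subsetD mult_inv_cancel_left inv_mult_cancel_left)
  then show "y \<in> carrier G \<and> inv g \<otimes> y \<otimes> g \<in> N" using x assms by auto
next
  assume y: "y \<in> carrier G \<and> inv g \<otimes> y \<otimes> g \<in> N"
  then have "y = g \<otimes> (inv g \<otimes> y \<otimes> g) \<otimes> inv g"
    using assms by (simp add: m_assoc mult_inv_cancel_left inv_mult_cancel_left)
  then show "y \<in> g <# N #> inv g" using y by (force simp: l_coset_def r_coset_def)
qed

lemma conjugate_subgroup:
  assumes N: "subgroup N G" and g: "g \<in> carrier G"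
  shows "subgroup (g <# N #> inv g) G"
proof (rule subgroupI)
  note m = mem_conjugate_iff[OF subgroup.subset[OF N] g]
  show "g <# N #> inv g \<subseteq> carrier G" using m by auto
  have "\<one> \<in> g <# N #> inv g" using g N by (simp add: m subgroup.one_closed)
  then show "g <# N #> inv g \<noteq> {}" by blast
  fix a assume a: "a \<in> g <# N #> inv g"
  then have "inv (inv g \<otimes> a \<otimes> g) \<in> N" using m N by (simp add: subgroup.m_inv_closed)
  then show "inv a \<in> g <# N #> inv g" using a g by (simp add: m inv_mult_group m_assoc)
  fix b assume b: "b \<in> g <# N #> inv g"
  have "(inv g \<otimes> a \<otimes> g) \<otimes> (inv g \<otimes> b \<otimes> g) \<in> N" using a b m N by (simp add: subgroup.m_closed)
  also have "(inv g \<otimes> a \<otimes> g) \<otimes> (inv g \<otimes> b \<otimes> g) = inv g \<otimes> (a \<otimes> b) \<otimes> g"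
    using a b g m by (simp add: m_assoc mult_inv_cancel_left inv_mult_cancel_left)
  finally show "a \<otimes> b \<in> g <# N #> inv g" using a b g by (simp add: m)
qed

lemma normal_core_subset:
  assumes "subgroup N G" shows "normal_core G N \<subseteq> N"
proof
  fix y assume "y \<in> normal_core G N"
  then have "y \<in> \<one> <# N #> inv \<one>" unfolding normal_core_def by blast
  then show "y \<in> N" using assms by (simp add: lcos_mult_one subgroup.subset coset_mult_one)
qed

lemma normal_core_normal:
  assumes N: "subgroup N G" shows "normal_core G N \<lhd> G"
  unfolding normal_inv_iff
proof
  show "subgroup (normal_core G N) G" unfolding normal_core_def
    using conjugate_subgroup[OF N] by (intro subgroups_Inter) auto
  note m = mem_conjugate_iff[OF subgroup.subset[OF N]]
  show "\<forall>x\<in>carrier G. \<forall>y\<in>normal_core G N. x \<otimes> y \<otimes> inv x \<in> normal_core G N"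
  proof (intro ballI)
    fix x y assume x: "x \<in> carrier G" and y: "y \<in> normal_core G N"
    then have yc: "y \<in> carrier G" using normal_core_subset[OF N] subgroup.subset[OF N] by blast
    show "x \<otimes> y \<otimes> inv x \<in> normal_core G N" unfolding normal_core_def
    proof
      fix g assume g: "g \<in> carrier G"
      have "y \<in> (inv x \<otimes> g) <# N #> inv (inv x \<otimes> g)"
        using y x g unfolding normal_core_def by blast
      then have "inv (inv x \<otimes> g) \<otimes> y \<otimes> (inv x \<otimes> g) \<in> N" using x g by (simp add: m)
      then show "x \<otimes> y \<otimes> inv x \<in> g <# N #> inv g"
        using x g yc by (simp add: m inv_mult_group m_assoc)
    qed
  qed
qed

text \<open>A normal subgroup \<open>N\<close> of \<open>H\<close> has one conjugate in \<open>G\<close> for each coset of \<open>H\<close>, at most; here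
  \<open>r\<close> picks a representative of each coset.\<close>
lemma normal_core_eq_Inter_representatives:
  assumes H: "subgroup H G" and N: "N \<lhd> G\<lparr>carrier := H\<rparr>"
    and r: "\<And>C. C \<in> rcosets H \<Longrightarrow> r C \<in> C"
  shows "normal_core G N = (\<Inter>C\<in>rcosets H. inv (r C) <# N #> r C)"
proof (intro equalityI subsetI)
  have Ns: "subgroup N G" using N H incl_subgroup normal_imp_subgroup by blast
  note m = mem_conjugate_iff[OF subgroup.subset[OF Ns]]
  have rc: "r C \<in> carrier G" if "C \<in> rcosets H" for C
    using r[OF that] subgroup.rcosets_carrier[OF H is_group that] by blast
  {
    fix y assume "y \<in> normal_core G N"
    then have "y \<in> inv (r C) <# N #> inv (inv (r C))" if "C \<in> rcosets H" for C
      using inv_closed[OF rc[OF that]] unfolding normal_core_def by blast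
    then show "y \<in> (\<Inter>C\<in>rcosets H. inv (r C) <# N #> r C)" using rc by auto
  next
    fix y assume y: "y \<in> (\<Inter>C\<in>rcosets H. inv (r C) <# N #> r C)"
    show "y \<in> normal_core G N" unfolding normal_core_def
    proof
      fix g assume g: "g \<in> carrier G"
      let ?C = "H #> inv g"
      have C: "?C \<in> rcosets H" using g by (auto simp: rcosets_eq_image)
      have "H #> r ?C = ?C" using repr_independence[OF r[OF C] _ H] g by simp
      then have "inv g \<in> H #> r ?C" using rcos_self[OF _ H, of "inv g"] g by simp
      then obtain k where k: "k \<in> H" "inv g = k \<otimes> r ?C" by (auto simp: r_coset_def)
      have kc: "k \<in> carrier G" using k H by (simp add: subgroup.mem_carrier)
      have "y \<in> inv (r ?C) <# N #> inv (inv (r ?C))" using y C rc[OF C] by simp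
      then have yN: "y \<in> carrier G" "r ?C \<otimes> y \<otimes> inv (r ?C) \<in> N"
        using iffD1[OF m[OF inv_closed[OF rc[OF C]]]] rc[OF C] by fastforce+
      have "k \<otimes> (r ?C \<otimes> y \<otimes> inv (r ?C)) \<otimes> inv\<^bsub>G\<lparr>carrier := H\<rparr>\<^esub> k \<in> N"
        using normal.inv_op_closed2[OF N, of k] k yN by simp
      then have "k \<otimes> (r ?C \<otimes> y \<otimes> inv (r ?C)) \<otimes> inv k \<in> N"
        using k H by simp
      also have "k \<otimes> (r ?C \<otimes> y \<otimes> inv (r ?C)) \<otimes> inv k = (k \<otimes> r ?C) \<otimes> y \<otimes> inv (k \<otimes> r ?C)"
        using kc yN rc[OF C] by (simp add: m_assoc inv_mult_group)
      also have "\<dots> = inv g \<otimes> y \<otimes> g" using g by (simp flip: k(2))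
      finally show "y \<in> g <# N #> inv g" using g yN by (simp add: m)
    qed
  }
qed

text \<open>Conjugation by \<open>inv g\<close> maps \<open>D\<close> onto itself and \<open>g <# N #> inv g\<close> onto \<open>N\<close>, so a coset of the
  intersection in \<open>D\<close> is cut out by a coset of \<open>N\<close> in \<open>H\<close>.\<close>
lemma subgroup_index_conjugate_Int_le:
  assumes D: "D \<lhd> G" and H: "subgroup H G" and DH: "D \<subseteq> H"
    and N: "subgroup N G" and g: "g \<in> carrier G"
  shows "subgroup_index (G\<lparr>carrier := D\<rparr>) (D \<inter> (g <# N #> inv g))
    \<le> subgroup_index (G\<lparr>carrier := H\<rparr>) N"
proof -
  let ?B = "D \<inter> (g <# N #> inv g)" and ?f = "\<lambda>E. {y \<in> D. inv g \<otimes> y \<otimes> g \<in> E}"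
  note m = mem_conjugate_iff[OF subgroup.subset[OF N] g]
  have Ds: "subgroup D G" using D by (rule normal_imp_subgroup)
  have dc: "d \<in> carrier G" if "d \<in> D" for d using that Ds by (simp add: subgroup.mem_carrier)
  have eq: "?B #> d = ?f (N #> (inv g \<otimes> d \<otimes> g))" if d: "d \<in> D" for d
  proof (intro equalityI subsetI)
    fix y assume "y \<in> ?B #> d"
    then obtain b where b: "b \<in> ?B" "y = b \<otimes> d" by (auto simp: r_coset_def)
    then have "inv g \<otimes> y \<otimes> g = (inv g \<otimes> b \<otimes> g) \<otimes> (inv g \<otimes> d \<otimes> g)"
      using dc[OF d] g m by (simp add: m_assoc mult_inv_cancel_left inv_mult_cancel_left)
    moreover have "inv g \<otimes> b \<otimes> g \<in> N" using b m by blast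
    moreover have "y \<in> D" using b d Ds by (simp add: subgroup.m_closed)
    ultimately show "y \<in> ?f (N #> (inv g \<otimes> d \<otimes> g))" by (auto simp: r_coset_def)
  next
    fix y assume y: "y \<in> ?f (N #> (inv g \<otimes> d \<otimes> g))"
    then obtain x where x: "x \<in> N" "inv g \<otimes> y \<otimes> g = x \<otimes> (inv g \<otimes> d \<otimes> g)"
      by (auto simp: r_coset_def)
    have xc: "x \<in> carrier G" using x N by (simp add: subgroup.mem_carrier)
    have yc: "y \<in> carrier G" using y dc by simp
    have "inv g \<otimes> (y \<otimes> inv d) \<otimes> g = (inv g \<otimes> y \<otimes> g) \<otimes> inv (inv g \<otimes> d \<otimes> g)"
      using dc[OF d] yc g by (simp add: m_assoc inv_mult_group mult_inv_cancel_left inv_mult_cancel_left)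
    also have "\<dots> = x" using x xc dc[OF d] g by (simp add: m_assoc)
    finally have "inv g \<otimes> (y \<otimes> inv d) \<otimes> g \<in> N" using x by simp
    moreover have "y \<otimes> inv d \<in> D" using y d Ds by (simp add: subgroup.m_closed subgroup.m_inv_closed)
    ultimately have "y \<otimes> inv d \<in> ?B" using m dc by blast
    moreover have "y = (y \<otimes> inv d) \<otimes> d" using yc dc[OF d] by (simp add: m_assoc)
    ultimately show "y \<in> ?B #> d" by (auto simp: r_coset_def)
  qed
  have "inv g \<otimes> d \<otimes> g \<in> H" if "d \<in> D" for d
    using normal.inv_op_closed1[OF D g that] DH by blast
  then have sub: "rcosets\<^bsub>G\<lparr>carrier := D\<rparr>\<^esub> ?B \<subseteq> ?f ` (rcosets\<^bsub>G\<lparr>carrier := H\<rparr>\<^esub> N)"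
    by (auto simp: rcosets_subgroup_eq_image eq)
  show ?thesis
  proof (cases "finite (rcosets\<^bsub>G\<lparr>carrier := H\<rparr>\<^esub> N)")
    case True
    then have "card (rcosets\<^bsub>G\<lparr>carrier := D\<rparr>\<^esub> ?B) \<le> card (rcosets\<^bsub>G\<lparr>carrier := H\<rparr>\<^esub> N)"
      using sub by (meson card_image_le card_mono finite_imageI order_trans)
    then show ?thesis using True finite_subset[OF sub] by (auto simp: subgroup_index_def)
  qed (simp add: subgroup_index_def)
qed

text \<open>Inside the core \<open>D\<close> of \<open>H\<close>, the core of \<open>N\<close> is an intersection of \<open>|G : H|\<close> subgroups
  \<open>D \<inter> N\<^sup>x\<close>, each of index at most \<open>|H : N|\<close> in \<open>D\<close>.\<close>
lemma subgroup_index_normal_core_le: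
  assumes H: "subgroup H G" and fin: "finite (rcosets H)"
    and N: "N \<lhd> G\<lparr>carrier := H\<rparr>" and n: "subgroup_index (G\<lparr>carrier := H\<rparr>) N \<le> enat n"
  shows "subgroup_index G (normal_core G N)
    \<le> subgroup_index G (normal_core G H) * enat (n ^ card (rcosets H))"
proof -
  define r where "r C = (SOME g. g \<in> C)" for C :: "'a set"
  have r: "r C \<in> C" if "C \<in> rcosets H" for C
    using subgroup.rcosets_non_empty[OF H that] unfolding r_def by (auto intro: someI)
  have rc: "r C \<in> carrier G" if "C \<in> rcosets H" for C
    using r[OF that] subgroup.rcosets_carrier[OF H is_group that] by blast
  have Ns: "subgroup N G" using N H incl_subgroup normal_imp_subgroup by blast
  have NH: "N \<subseteq> H" using subgroup.subset[OF normal_imp_subgroup[OF N]] by simp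
  let ?D = "normal_core G H"
  have D: "?D \<lhd> G" "subgroup ?D G" "?D \<subseteq> H"
    using normal_core_normal[OF H] normal_core_subset[OF H] by (auto dest: normal_imp_subgroup)
  have CD: "normal_core G N \<subseteq> ?D"
    using NH by (fastforce simp: normal_core_def l_coset_def r_coset_def)
  let ?B = "\<lambda>C. ?D \<inter> (inv (r C) <# N #> inv (inv (r C)))"
  interpret D: group "G\<lparr>carrier := ?D\<rparr>" by (rule subgroup_imp_group[OF D(2)])
  have "normal_core G N = ?D \<inter> (\<Inter>C\<in>rcosets H. ?B C)"
    using CD rc normal_core_eq_Inter_representatives[OF H N r] by auto
  moreover have "subgroup (?B C) (G\<lparr>carrier := ?D\<rparr>)" if "C \<in> rcosets H" for C
    using rc[OF that]
    by (intro subgroup_incl subgroups_Inter_pair D conjugate_subgroup Ns) auto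
  ultimately have "subgroup_index (G\<lparr>carrier := ?D\<rparr>) (normal_core G N)
      \<le> (\<Prod>C\<in>rcosets H. subgroup_index (G\<lparr>carrier := ?D\<rparr>) (?B C))"
    using D.subgroup_index_Inter_le_prod[OF fin, of ?B] by simp
  also have "\<dots> \<le> enat (n ^ card (rcosets H))"
  proof (rule prod_enat_le_power[OF fin])
    fix C assume "C \<in> rcosets H"
    then show "subgroup_index (G\<lparr>carrier := ?D\<rparr>) (?B C) \<le> enat n"
      using subgroup_index_conjugate_Int_le[OF D(1) H D(3) Ns inv_closed[OF rc]] n
      by (meson order_trans)
  qed
  finally show ?thesis
    using subgroup_index_mult[OF D(2) normal_imp_subgroup[OF normal_core_normal[OF Ns]] CD]
    by (simp add: mult_left_mono)
qed

end

context topological_group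
begin

lemma normal_core_openin:
  assumes H: "subgroup H G" and fin: "finite (rcosets H)"
    and N: "N \<lhd> G\<lparr>carrier := H\<rparr>" and No: "openin T N"
  shows "openin T (normal_core G N)"
proof -
  define r where "r C = (SOME g. g \<in> C)" for C :: "'a set"
  have r: "r C \<in> C" if "C \<in> rcosets H" for C
    using subgroup.rcosets_non_empty[OF H that] unfolding r_def by (auto intro: someI)
  have rc: "r C \<in> carrier G" if "C \<in> rcosets H" for C
    using r[OF that] subgroup.rcosets_carrier[OF H is_group that] by blast
  have "rcosets H \<noteq> {}" by (auto simp: rcosets_eq_image)
  then have "openin T (\<Inter>C\<in>rcosets H. inv (r C) <# N #> r C)"
    using rc fin by (intro openin_INT2 openin_r_coset openin_l_coset No) auto
  then show ?thesis by (simp add: normal_core_eq_Inter_representatives[OF H N r])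
qed

end

section \<open>Bounding strong obliquity of a subgroup\<close>

context profinite_group
begin

text \<open>If \<open>N\<close> is open normal in \<open>H\<close> of index at most \<open>n\<close>, its core in \<open>G\<close> has index at most
  \<open>t * n ^ h\<close>, so \<open>I_normal G T (t * n ^ h)\<close> lies in \<open>N\<close>. Open subgroups of \<open>H\<close> are open in \<open>G\<close>, and
  the condition of being normalised is inherited by the smaller group.\<close>
lemma OI_star_subset_of_subgroup:
  assumes H: "subgroup H G" "openin T H" and t: "t = card (rcosets (normal_core G H))"
    and h: "h = card (rcosets H)" and n: "n \<ge> 1"
  shows "OI_star G T (t * n ^ h) \<subseteq> OI_star (G\<lparr>carrier := H\<rparr>) (subtopology T H) n"
proof -
  let ?H = "G\<lparr>carrier := H\<rparr>" and ?T = "subtopology T H" and ?n = "t * n ^ h"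
  have fin: "finite (rcosets H)" by (rule open_subgroup_finite_index[OF H])
  have HH: "H \<lhd> ?H"
    using group.normal_invI[OF subgroup_imp_group[OF H(1)]] group.subgroup_self[OF subgroup_imp_group[OF H(1)]]
      group.inv_closed[OF subgroup_imp_group[OF H(1)]] H(1)
    by (simp add: subgroup.m_closed subgroup.m_inv_closed)
  have tD: "subgroup_index G (normal_core G H) = enat t"
    using open_subgroup_finite_index[OF normal_imp_subgroup[OF normal_core_normal[OF H(1)]]
        normal_core_openin[OF H(1) fin HH H(2)]]
    by (simp add: subgroup_index_def t)
  have opH: "openin T K" if "openin ?T K" for K
    using that H(2) by (simp add: openin_open_subtopology)
  have "I_normal G T ?n \<subseteq> N" if N: "open_normal N ?H ?T" "subgroup_index ?H N \<le> enat n" for N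
  proof -
    have Nn: "N \<lhd> ?H" and No: "openin T N" using N(1) opH by (auto simp: open_normal_def)
    have Ns: "subgroup N G" using incl_subgroup[OF H(1) normal_imp_subgroup[OF Nn]] .
    have "subgroup_index G (normal_core G N) \<le> enat ?n"
      using subgroup_index_normal_core_le[OF H(1) fin Nn N(2)] by (simp add: tD h)
    then have "I_normal G T ?n \<subseteq> normal_core G N"
      using normal_core_normal[OF Ns] normal_core_openin[OF H(1) fin Nn No]
      by (intro I_normal_subset_if_index_le) (auto simp: open_normal_def)
    then show ?thesis using normal_core_subset[OF Ns] by blast
  qed
  moreover have "I_normal G T ?n \<subseteq> H"
  proof -
    \<comment> \<open>This uses \<open>n \<ge> 1\<close>: for \<open>n = 0\<close> the left side is all of \<open>G\<close>.\<close>
    have "I_normal G T ?n \<subseteq> normal_core G H"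
      using normal_core_normal[OF H(1)] normal_core_openin[OF H(1) fin HH H(2)] n
      by (intro I_normal_subset_if_index_le) (auto simp: open_normal_def tD)
    then show ?thesis using normal_core_subset[OF H(1)] by blast
  qed
  ultimately have II: "I_normal G T ?n \<subseteq> I_normal ?H ?T n"
    unfolding I_normal_def[of ?H] by auto
  have "OI_star G T ?n \<subseteq> K"
    if K: "open_subgroup K ?H ?T" "I_normal ?H ?T n \<subseteq> normalizer ?H K" "\<not> K \<subseteq> I_normal ?H ?T n" for K
  proof -
    have "K \<subseteq> H" using K(1) subgroup.subset by (force simp: open_subgroup_def)
    then have "I_normal G T ?n \<subseteq> normalizer G K"
      using K(2) II mem_normalizer_subgroup[OF H(1)] by blast
    moreover have "open_subgroup K G T"
      using K(1) opH incl_subgroup[OF H(1)] by (auto simp: open_subgroup_def)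
    ultimately show ?thesis using K(3) II by (auto simp: OI_star_def Ob_star_def)
  qed
  moreover have "OI_star G T ?n \<subseteq> I_normal ?H ?T n"
    using II by (auto simp: OI_star_def Ob_star_def)
  ultimately show ?thesis
    unfolding OI_star_def[of ?H] Ob_star_def[of ?H] by blast
qed

section \<open>Bounding strong obliquity by obliquities of overgroups\<close>

text \<open>An open subgroup \<open>K\<close> normalised by \<open>I_normal G T n\<close> is normal in its normaliser \<open>L\<close>, which is one
  of the groups above \<open>I_normal G T n\<close>; so \<open>OI\<close> of \<open>L\<close> lies in \<open>K\<close>.\<close>
lemma Inter_OI_subset_OI_star:
  "carrier G \<inter> (\<Inter>L\<in>subgroups_above G T n. OI (G\<lparr>carrier := L\<rparr>) (subtopology T L) n)
    \<subseteq> OI_star G T n" (is "?J \<subseteq> _")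
proof -
  let ?I = "I_normal G T n"
  have "carrier G \<in> subgroups_above G T n"
    using closedin_topspace[of T]
    by (auto simp: subgroups_above_def closed_subgroup_def subgroup_self topspace_eq I_normal_def)
  then have "?J \<subseteq> OI (G\<lparr>carrier := carrier G\<rparr>) (subtopology T (carrier G)) n" by blast
  then have "?J \<subseteq> ?I" 
    using I_normal_of_subgroup_mono[OF subgroup_self, of n] by (auto simp: OI_def Ob_def)
  moreover have "?J \<subseteq> K"
    if K: "open_subgroup K G T" "?I \<subseteq> normalizer G K" "\<not> K \<subseteq> ?I" for K
  proof -
    let ?L = "normalizer G K"
    have Ks: "subgroup K G" "openin T K" using K(1) by (auto simp: open_subgroup_def)
    have L: "subgroup ?L G"
      using normalizer_imp_subgroup subgroup.subset[OF Ks(1)] by blast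
    have KL: "K \<lhd> G\<lparr>carrier := ?L\<rparr>" by (rule subgroup_in_normalizer[OF Ks(1)])
    then have sub: "K \<subseteq> ?L" using subgroup.subset[OF normal_imp_subgroup] by fastforce
    have "closedin T ?L"
      using open_subgroup_closedin[OF L openin_supergroup[OF Ks L sub]] .
    then have "?L \<in> subgroups_above G T n"
      using L K(2) by (simp add: subgroups_above_def closed_subgroup_def)
    moreover have "open_normal K (G\<lparr>carrier := ?L\<rparr>) (subtopology T ?L)"
      using KL Ks(2) sub by (auto simp: open_normal_def openin_subtopology)
    moreover have "\<not> K \<subseteq> I_normal (G\<lparr>carrier := ?L\<rparr>) (subtopology T ?L) n"
      using K(3) I_normal_of_subgroup_mono[OF L, of n] by blast
    ultimately show ?thesis by (force simp: OI_def Ob_def)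
  qed
  ultimately show ?thesis unfolding OI_star_def Ob_star_def by blast
qed

end

context just_infinite_profinite_group
begin

text \<open>If \<open>I_normal G T n\<close> had infinite index, it would be trivial. Then the indices of open normal
  subgroups are unbounded, since one of maximal index would lie in every other one and hence be
  trivial. Choosing \<open>U\<close> open normal of index greater than \<open>n\<close>, the subgroups defining
  \<open>I_normal G T n\<close> are not contained in \<open>U\<close>, so there are finitely many of them.\<close>
lemma I_normal_finite_index: "finite (rcosets (I_normal G T n))"
proof (rule ccontr)
  assume inf: "infinite (rcosets (I_normal G T n))"
  have ind: "subgroup_index G N = enat (card (rcosets N))" if "open_normal N G T" for N
    using that open_subgroup_finite_index open_normal_subgroup
    by (auto simp: open_normal_def subgroup_index_def)
  have "closedin T (I_normal G T n)"
    unfolding I_normal_def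
    using closedin_topspace[of T] open_subgroup_closedin open_normal_subgroup
    by (intro closedin_Inter[of "insert _ _", simplified]) (auto simp: topspace_eq open_normal_def)
  then have I1: "I_normal G T n = {\<one>}"
    using inf normal_finite_rcosets[OF I_normal_normal] by blast
  have "\<exists>U. open_normal U G T \<and> n < card (rcosets U)"
  proof (rule ccontr)
    assume "\<nexists>U. open_normal U G T \<and> n < card (rcosets U)"
    then have le: "card (rcosets N) \<le> n" if "open_normal N G T" for N
      using that by (meson not_less)
    let ?c = "\<lambda>N. card (rcosets N)"
    have "\<exists>M. open_normal M G T \<and> (\<forall>N. open_normal N G T \<longrightarrow> ?c N \<le> ?c M)"
      by (rule ex_has_greatest_nat[where b = "Suc n"], rule open_normal_carrier)
        (simp add: le le_imp_less_Suc)
    then obtain M where M: "open_normal M G T" "\<And>N. open_normal N G T \<Longrightarrow> ?c N \<le> ?c M"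
      by (elim exE conjE) simp
    have "M \<subseteq> N" if N: "open_normal N G T" for N
    proof -
      have MN: "open_normal (M \<inter> N) G T" by (rule open_normal_Int[OF M(1) N])
      have eq: "subgroup_index G (M \<inter> N)
        = subgroup_index G M * subgroup_index (G\<lparr>carrier := M\<rparr>) (M \<inter> N)"
        using MN M by (intro subgroup_index_mult open_normal_subgroup) auto
      have "subgroup_index G (M \<inter> N) \<le> subgroup_index G M"
        using M(2)[OF MN] by (simp add: ind[OF MN] ind[OF M(1)])
      then have "subgroup_index G M * subgroup_index (G\<lparr>carrier := M\<rparr>) (M \<inter> N)
          \<le> subgroup_index G M"
        by (simp only: eq)
      then have "enat (?c M) * subgroup_index (G\<lparr>carrier := M\<rparr>) (M \<inter> N) \<le> enat (?c M) * 1"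
        by (simp add: ind[OF M(1)])
      moreover have "0 < ?c M"
        using M(1) open_subgroup_finite_index open_normal_subgroup
        by (intro card_rcosets_gt_0) (auto simp: open_normal_def)
      ultimately have "subgroup_index (G\<lparr>carrier := M\<rparr>) (M \<inter> N) \<le> 1"
        by (cases "subgroup_index (G\<lparr>carrier := M\<rparr>) (M \<inter> N)")
          (auto simp: one_enat_def zero_enat_def)
      then have "M = M \<inter> N"
        using MN M by (intro subgroup_index_le_1_imp_eq open_normal_subgroup) auto
      then show "M \<subseteq> N" by blast
    qed
    then have "M \<subseteq> I_normal G T n"
      using subgroup.subset[OF open_normal_subgroup[OF M(1)]] by (auto simp: I_normal_def)
    then have "M = {\<one>}" using I1 subgroup.one_closed[OF open_normal_subgroup[OF M(1)]] by auto
    then show False using open_normal_ne_one[OF M(1)] by simp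
  qed
  then obtain U where U: "open_normal U G T" "n < card (rcosets U)" by blast
  define F where "F = {N. open_normal N G T \<and> subgroup_index G N \<le> enat n}"
  have "F \<subseteq> {K. open_normal K G T \<and> \<not> K \<subseteq> U}"
  proof
    fix N assume N: "N \<in> F"
    then have No: "open_normal N G T" by (simp add: F_def)
    have "enat (card (rcosets U)) \<le> enat n" if "N \<subseteq> U"
    proof -
      have "subgroup_index G U \<le> subgroup_index G N"
        using that U(1) No by (intro subgroup_index_antimono open_normal_subgroup)
      also have "\<dots> \<le> enat n" using N by (simp add: F_def)
      finally show ?thesis by (simp add: ind[OF U(1)])
    qed
    with U No show "N \<in> {K. open_normal K G T \<and> \<not> K \<subseteq> U}" by auto
  qed
  moreover have "finite {K. open_normal K G T \<and> \<not> K \<subseteq> U}"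
    using U(1) subgroup.one_closed[OF open_normal_subgroup]
    by (intro finite_open_normal_outside) (auto simp: open_normal_def)
  ultimately have F: "finite F" by (rule finite_subset)
  have eq: "I_normal G T n = carrier G \<inter> (\<Inter>N\<in>F. N)" by (simp add: I_normal_def F_def)
  have "openin T (\<Inter>(insert (carrier G) F))"
    using F openin_topspace[of T]
    by (intro openin_Inter) (auto simp: F_def open_normal_def topspace_eq)
  then have "openin T (I_normal G T n)" by (simp add: eq)
  then show False
    using inf open_subgroup_finite_index[OF I_normal_subgroup] by blast
qed

lemma finite_subgroups_above: "finite (subgroups_above G T n)"
  by (rule finite_subset[OF _ finite_supergroups[OF I_normal_subgroup I_normal_finite_index]])
    (auto simp: subgroups_above_def closed_subgroup_def)

lemma ob_star_le_prod:
  "ob_star G T n \<le> (\<Prod>L\<in>subgroups_above G T n. subgroup_index G L * ob_subgroup G T L n)"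
proof -
  let ?O = "\<lambda>L. OI (G\<lparr>carrier := L\<rparr>) (subtopology T L) n" and ?S = "subgroups_above G T n"
  have S: "subgroup L G" if "L \<in> ?S" for L
    using that by (simp add: subgroups_above_def closed_subgroup_def)
  have O: "subgroup (?O L) G" if "L \<in> ?S" for L
    by (rule OI_of_subgroup(1)[OF S[OF that]])
  have "ob_star G T n \<le> subgroup_index G (carrier G \<inter> (\<Inter>L\<in>?S. ?O L))"
    unfolding ob_star_def
    by (intro subgroup_index_antimono OI_star_subgroup Inter_OI_subset_OI_star
        subgroup_Int_Inter subgroup_self) (use O in auto)
  also have "\<dots> \<le> (\<Prod>L\<in>?S. subgroup_index G (?O L))"
    by (rule subgroup_index_Inter_le_prod[OF finite_subgroups_above O])
  also have "\<dots> = (\<Prod>L\<in>?S. subgroup_index G L * ob_subgroup G T L n)"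
    by (intro prod.cong refl subgroup_index_OI_of_subgroup S)
  finally show ?thesis .
qed

end

theorem theoremC:
  fixes G :: "('a, 'b) monoid_scheme" and T :: "'a topology" and H :: "'a set" and h :: nat
  assumes "just_infinite_profinite_group G T"
    and "closed_subgroup H G T"
    and "subgroup_index G H = enat h"
  shows "(\<forall>\<^sub>F n in sequentially.
            inverse (of_nat h) * ennreal_of_enat (ob G T (h * n))
              \<le> ennreal_of_enat (ob_subgroup G T H n))
       \<and> (let t = card (rcosets\<^bsub>G\<^esub> (normal_core G H)) in
            \<forall>n\<ge>1. ennreal_of_enat (ob_star_subgroup G T H n)
              \<le> inverse (of_nat h) * ennreal_of_enat (ob_star G T (t * n ^ h)))
       \<and> (\<forall>n\<ge>1. ob_star G T n
              \<le> (\<Prod>L\<in>subgroups_above G T n. subgroup_index G L * ob_subgroup G T L n))"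
proof -
  interpret just_infinite_profinite_group G T by fact
  have Hs: "subgroup H G" and Hc: "closedin T H"
    using assms(2) by (simp_all add: closed_subgroup_def)
  have h: "subgroup_index G H = enat h" by fact
  have fin: "finite (rcosets\<^bsub>G\<^esub> H)" and hc: "h = card (rcosets\<^bsub>G\<^esub> H)"
    using h by (simp_all add: subgroup_index_def split: if_splits)
  have h0: "0 < h" using card_rcosets_gt_0[OF fin] hc by simp
  have Ho: "openin T H" by (rule closed_finite_index_openin[OF Hs Hc fin])
  have cancel: "inverse (of_nat h) * (of_nat h * x) = x" for x :: ennreal
  proof -
    have "of_nat h * inverse (of_nat h) = (1 :: ennreal)"
      using ennreal_divide_self[of "of_nat h"] h0 by (simp add: divide_ennreal_def of_nat_less_top)
    then show ?thesis by (simp add: mult.commute mult.left_commute)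
  qed
  have "\<forall>\<^sub>F n in sequentially. inverse (of_nat h) * ennreal_of_enat (ob G T (h * n))
      \<le> ennreal_of_enat (ob_subgroup G T H n)"
    using OI_of_subgroup_eventually_subset[OF Hs Ho h]
  proof eventually_elim
    fix n assume "OI (G\<lparr>carrier := H\<rparr>) (subtopology T H) n \<subseteq> OI G T (h * n)"
    then have "ob G T (h * n) \<le> enat h * ob_subgroup G T H n"
      unfolding ob_def[of G] h[symmetric] subgroup_index_OI_of_subgroup[OF Hs, symmetric]
      by (intro subgroup_index_antimono OI_subgroup OI_of_subgroup(1) Hs)
    then have "ennreal_of_enat (ob G T (h * n)) \<le> of_nat h * ennreal_of_enat (ob_subgroup G T H n)"
      by (metis ennreal_of_enat_enat ennreal_of_enat_le_iff ennreal_of_enat_mult)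
    then have "inverse (of_nat h) * ennreal_of_enat (ob G T (h * n))
        \<le> inverse (of_nat h) * (of_nat h * ennreal_of_enat (ob_subgroup G T H n))"
      by (rule mult_left_mono) simp
    then show "inverse (of_nat h) * ennreal_of_enat (ob G T (h * n))
        \<le> ennreal_of_enat (ob_subgroup G T H n)"
      by (simp only: cancel)
  qed
  moreover have "ennreal_of_enat (ob_star_subgroup G T H n)
      \<le> inverse (of_nat h) * ennreal_of_enat (ob_star G T (card (rcosets\<^bsub>G\<^esub> (normal_core G H)) * n ^ h))"
    if n: "n \<ge> 1" for n
  proof -
    let ?m = "card (rcosets\<^bsub>G\<^esub> (normal_core G H)) * n ^ h"
    have "enat h * ob_star_subgroup G T H n \<le> ob_star G T ?m"
      unfolding ob_star_def[of G] h[symmetric] subgroup_index_OI_star_of_subgroup[OF Hs, symmetric]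
      by (intro subgroup_index_antimono OI_star_subgroup OI_star_of_subgroup(1) Hs
          OI_star_subset_of_subgroup Ho hc n refl)
    then have "of_nat h * ennreal_of_enat (ob_star_subgroup G T H n) \<le> ennreal_of_enat (ob_star G T ?m)"
      by (metis ennreal_of_enat_enat ennreal_of_enat_le_iff ennreal_of_enat_mult)
    then have "inverse (of_nat h) * (of_nat h * ennreal_of_enat (ob_star_subgroup G T H n))
        \<le> inverse (of_nat h) * ennreal_of_enat (ob_star G T ?m)"
      by (rule mult_left_mono) simp
    then show ?thesis by (simp only: cancel)
  qed
  ultimately show ?thesis using ob_star_le_prod by (simp add: Let_def)
qed

end
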